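(* Let $X=\{x_1,x_2,\ldots\}$ be a finite or infinite set of indeterminates, let $t$ be a further indeterminate, and let $\frac{X}{1-tX}$ denote the alphabet $\left\{\frac{x_1}{1-tx_1},\frac{x_2}{1-tx_2},\ldots\right\}$. For every integer $k\ge 1$ one has, as formal power series in $t$, $$h_k\left(\frac{X}{1-tX}\right)=\sum_{|\mu|\ge k}t^{|\mu|-k}\,\frac{\left\langle{\mu\atop k}\right\rangle}{z_\mu}\,p_\mu(X),$$ $$e_k\left(\frac{X}{1-tX}\right)=\sum_{|\mu|\ge k}t^{|\mu|-k}(-1)^{k-l(\mu)}\,\frac{\left\langle{\mu\atop k}\right\rangle}{z_\mu}\,p_\mu(X),$$ where both sums run over all integer partitions $\mu$ with $|\mu|\ge k$.
   Context: For an integer partition $\mu=(\mu_1,\mu_2,\ldots)$: $|\mu|$ is the sum of its parts, $l(\mu)$ its number of (nonzero) parts, $m_i(\mu)$ the number of parts equal to $i\ge1$, and $z_\mu=\prod_{i\ge1}i^{m_i(\mu)}m_i(\mu)!$. The generalized binomial coefficient $\left\langle{\mu\atop k}\right\rangle$ (for an integer $k\ge0$) is the number of ways to choose $k$ cells in the Ferrers diagram of $\mu$ with at least one cell chosen in each row; equivalently, with $l=l(\mu)$, $\left\langle{\mu\atop k}\right\rangle=\sum_{k_1+\cdots+k_l=k,\;k_1,\ldots,k_l\ge1}\prod_{i=1}^l\binom{\mu_i}{k_i}$. For an alphabet $A=\{a_1,a_2,\ldots\}$: $p_n(A)=\sum_{r\ge1}a_r^n$, $p_\mu(A)=\prod_r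 p_{\mu_r}(A)$ (product over the parts of $\mu$), and $e_n(A)$, $h_n(A)$ are the elementary and complete homogeneous symmetric functions, with $\sum_{n\ge0}e_n(A)s^n=\prod_{r\ge1}(1+a_rs)$ and $\sum_{n\ge0}h_n(A)s^n=\prod_{r\ge1}(1-a_rs)^{-1}$. The fractions $\frac{x_r}{1-tx_r}$ are expanded as power series in $t$. *)

theory Defs
  imports "HOL-Analysis.Analysis" "HOL-Library.Poly_Mapping"
begin

section \<open>Power series in an arbitrary set of commuting indeterminates\<close>

text \<open>
  A power series assigns a coefficient to every monomial; a monomial is a finitely supported
  exponent vector. This is the ring in which symmetric functions of infinitely many
  indeterminates live.
\<close>

typedef ('i, 'a) mfps = "UNIV :: (('i, nat) poly_mapping \<Rightarrow> 'a) set"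
  morphisms mcoeff Abs_mfps
  by simp

lemma mcoeff_Abs [simp]: "mcoeff (Abs_mfps f) = f"
  by (simp add: Abs_mfps_inverse)

lemma mfps_eqI: "(\<And>m. mcoeff f m = mcoeff g m) \<Longrightarrow> f = g"
  by (metis ext mcoeff_inject)

definition msplits :: "('i, nat) poly_mapping \<Rightarrow> (('i, nat) poly_mapping \<times> ('i, nat) poly_mapping) set"
  where "msplits m = {(a, b). a + b = m}"

lemma mem_msplits [simp]: "(a, b) \<in> msplits m \<longleftrightarrow> a + b = m"
  by (simp add: msplits_def)

lemma finite_msplits [simp]: "finite (msplits m)"
proof -
  let ?B = "{..Max (insert 0 (Poly_Mapping.lookup m ` Poly_Mapping.keys m))}"
  let ?S = "{f. \<forall>x. (x \<in> Poly_Mapping.keys m \<longrightarrow> f x \<in> ?B) \<and> (x \<notin> Poly_Mapping.keys m \<longrightarrow> f x = (0::nat))}"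
  let ?A = "{a. Poly_Mapping.lookup a \<in> ?S}"
  have "finite ?S" by (rule finite_set_of_finite_funs) auto
  then have "finite (Poly_Mapping.lookup -` ?S)"
    by (rule finite_vimageI) (simp add: inj_on_def poly_mapping_eqI)
  then have fin: "finite ?A" by (simp add: vimage_def)
  have sub: "a \<in> ?A" if "a + b = m" for a b
  proof -
    have le: "Poly_Mapping.lookup a x \<le> Poly_Mapping.lookup m x" for x
      using that by (auto simp: lookup_add)
    have "Poly_Mapping.lookup a x \<le> Max (insert 0 (Poly_Mapping.lookup m ` Poly_Mapping.keys m))" if "x \<in> Poly_Mapping.keys m" for x
      using le[of x] that by (meson Max_ge finite_imageI finite_insert finite_keys image_eqI
          insertI2 order_trans)
    moreover have "Poly_Mapping.lookup a x = 0" if "x \<notin> Poly_Mapping.keys m" for x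
      using le[of x] that by (simp add: in_keys_iff)
    ultimately show ?thesis by auto
  qed
  have "msplits m \<subseteq> ?A \<times> ?A"
  proof
    fix p assume "p \<in> msplits m"
    then have "fst p + snd p = m" "snd p + fst p = m"
      by (simp_all add: msplits_def case_prod_beta add.commute)
    from sub[OF this(1)] sub[OF this(2)] show "p \<in> ?A \<times> ?A"
      unfolding mem_Times_iff by (rule conjI)
  qed
  then show ?thesis using fin by (meson finite_SigmaI finite_subset)
qed

instantiation mfps :: (type, comm_ring_1) comm_ring_1
begin

definition zero_mfps :: "('a, 'b) mfps" where "0 = Abs_mfps (\<lambda>_. 0)"
definition one_mfps :: "('a, 'b) mfps" where "1 = Abs_mfps (\<lambda>m. if m = 0 then 1 else 0)"
definition plus_mfps :: "('a, 'b) mfps \<Rightarrow> ('a, 'b) mfps \<Rightarrow> ('a, 'b) mfps"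
  where "f + g = Abs_mfps (\<lambda>m. mcoeff f m + mcoeff g m)"
definition uminus_mfps :: "('a, 'b) mfps \<Rightarrow> ('a, 'b) mfps"
  where "- f = Abs_mfps (\<lambda>m. - mcoeff f m)"
definition minus_mfps :: "('a, 'b) mfps \<Rightarrow> ('a, 'b) mfps \<Rightarrow> ('a, 'b) mfps"
  where "f - g = Abs_mfps (\<lambda>m. mcoeff f m - mcoeff g m)"
definition times_mfps :: "('a, 'b) mfps \<Rightarrow> ('a, 'b) mfps \<Rightarrow> ('a, 'b) mfps"
  where "f * g = Abs_mfps (\<lambda>m. \<Sum>(a, b) \<in> msplits m. mcoeff f a * mcoeff g b)"

instance
proof
  fix f g h :: "('a, 'b) mfps"
  note defs = zero_mfps_def one_mfps_def plus_mfps_def uminus_mfps_def minus_mfps_def times_mfps_def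
  show "f + g + h = f + (g + h)" "f + g = g + f" "0 + f = f" "- f + f = 0" "f - g = f + - g"
    by (rule mfps_eqI; simp add: defs algebra_simps)+
  show "(0 :: ('a, 'b) mfps) \<noteq> 1"
  proof
    assume "(0 :: ('a, 'b) mfps) = 1"
    then have "mcoeff (0 :: ('a, 'b) mfps) 0 = mcoeff 1 0" by simp
    then show False by (simp add: defs)
  qed
  show "(f + g) * h = f * h + g * h"
    by (rule mfps_eqI) (simp add: defs algebra_simps sum.distrib case_prod_beta)
  show "f * g = g * f"
  proof (rule mfps_eqI)
    fix m
    show "mcoeff (f * g) m = mcoeff (g * f) m"
      unfolding times_mfps_def mcoeff_Abs
      by (rule sum.reindex_bij_witness[of _ prod.swap prod.swap]) (auto simp: algebra_simps)
  qed
  show "1 * f = f"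
  proof (rule mfps_eqI)
    fix m
    have "mcoeff (1 * f) m = (\<Sum>(a, b) \<in> {(0, m)}. mcoeff (1 :: ('a, 'b) mfps) a * mcoeff f b)"
      unfolding times_mfps_def mcoeff_Abs
      by (rule sum.mono_neutral_right) (auto simp: one_mfps_def split: if_splits)
    then show "mcoeff (1 * f) m = mcoeff f m" by (simp add: one_mfps_def)
  qed
  show "f * g * h = f * (g * h)"
  proof (rule mfps_eqI)
    fix m
    have "mcoeff (f * g * h) m =
        (\<Sum>(a, b) \<in> msplits m. \<Sum>(c, d) \<in> msplits a. mcoeff f c * mcoeff g d * mcoeff h b)"
      by (simp add: times_mfps_def sum_distrib_right case_prod_beta)
    also have "\<dots> = (\<Sum>(p, q) \<in> (SIGMA p:msplits m. msplits (fst p)).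
        mcoeff f (fst q) * mcoeff g (snd q) * mcoeff h (snd p))"
      by (subst sum.Sigma[symmetric]) (auto simp: case_prod_beta)
    also have "\<dots> = (\<Sum>(p, q) \<in> (SIGMA p:msplits m. msplits (snd p)).
        mcoeff f (fst p) * (mcoeff g (fst q) * mcoeff h (snd q)))"
      by (rule sum.reindex_bij_witness
          [of _ "\<lambda>((a, b), (c, d)). ((a + c, d), (a, c))" "\<lambda>((a, b), (c, d)). ((c, d + b), (d, b))"])
        (auto simp: algebra_simps)
    also have "\<dots> = (\<Sum>(a, b) \<in> msplits m. \<Sum>(c, d) \<in> msplits b. mcoeff f a * (mcoeff g c * mcoeff h d))"
      by (subst sum.Sigma[symmetric]) (auto simp: case_prod_beta)
    also have "\<dots> = mcoeff (f * (g * h)) m"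
      by (simp add: times_mfps_def sum_distrib_left case_prod_beta)
    finally show "mcoeff (f * g * h) m = mcoeff (f * (g * h)) m" .
  qed
qed

end

lemma mcoeff_0 [simp]: "mcoeff 0 m = 0"
  by (simp add: zero_mfps_def)

lemma mcoeff_1: "mcoeff 1 m = (if m = 0 then 1 else 0)"
  by (simp add: one_mfps_def)

lemma mcoeff_add [simp]: "mcoeff (f + g) m = mcoeff f m + mcoeff g m"
  by (simp add: plus_mfps_def)

lemma mcoeff_mult: "mcoeff (f * g) m = (\<Sum>(a, b) \<in> msplits m. mcoeff f a * mcoeff g b)"
  by (simp add: times_mfps_def)

lemma mcoeff_sum [simp]: "mcoeff (sum f A) m = (\<Sum>x\<in>A. mcoeff (f x) m)"
  by (induction A rule: infinite_finite_induct) auto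

definition mconst :: "'a \<Rightarrow> ('i, 'a::comm_ring_1) mfps"
  where "mconst c = Abs_mfps (\<lambda>m. if m = 0 then c else 0)"

definition mvar :: "'i \<Rightarrow> ('i, 'a::comm_ring_1) mfps"
  where "mvar i = Abs_mfps (\<lambda>m. if m = Poly_Mapping.single i 1 then 1 else 0)"

text \<open>
  The topology is that of coefficientwise convergence with discrete coefficients, i.e. the
  product topology of discrete spaces; see \<open>tendsto_mfps_iff\<close>.
\<close>

instantiation mfps :: (type, comm_ring_1) t2_space
begin

definition open_mfps :: "('a, 'b) mfps set \<Rightarrow> bool" where
  "open_mfps U \<longleftrightarrow> (\<forall>f\<in>U. \<exists>M. finite M \<and> (\<forall>g. (\<forall>m\<in>M. mcoeff g m = mcoeff f m) \<longrightarrow> g \<in> U))"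

instance
proof
  show "open (UNIV :: ('a, 'b) mfps set)" by (auto simp: open_mfps_def)
next
  fix S T :: "('a, 'b) mfps set" assume S: "open S" and T: "open T"
  show "open (S \<inter> T)"
    unfolding open_mfps_def
  proof
    fix f assume "f \<in> S \<inter> T"
    then have "f \<in> S" "f \<in> T" by auto
    from bspec[OF S[unfolded open_mfps_def] this(1)] bspec[OF T[unfolded open_mfps_def] this(2)]
    obtain M N where "finite M" "\<forall>g. (\<forall>m\<in>M. mcoeff g m = mcoeff f m) \<longrightarrow> g \<in> S"
      "finite N" "\<forall>g. (\<forall>m\<in>N. mcoeff g m = mcoeff f m) \<longrightarrow> g \<in> T"
      by (elim exE conjE)
    then show "\<exists>M. finite M \<and> (\<forall>g. (\<forall>m\<in>M. mcoeff g m = mcoeff f m) \<longrightarrow> g \<in> S \<inter> T)"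
      by (intro exI[of _ "M \<union> N"]) auto
  qed
next
  fix K :: "('a, 'b) mfps set set" assume K: "\<forall>S\<in>K. open S"
  show "open (\<Union>K)"
    unfolding open_mfps_def
  proof
    fix f assume "f \<in> \<Union>K"
    then obtain S where S: "S \<in> K" "f \<in> S" by blast
    then have "open S" using K by blast
    from bspec[OF this[unfolded open_mfps_def] S(2)]
    obtain M where "finite M" "\<forall>g. (\<forall>m\<in>M. mcoeff g m = mcoeff f m) \<longrightarrow> g \<in> S"
      by (elim exE conjE)
    then show "\<exists>M. finite M \<and> (\<forall>g. (\<forall>m\<in>M. mcoeff g m = mcoeff f m) \<longrightarrow> g \<in> \<Union>K)"
      using S(1) by (intro exI[of _ M]) blast
  qed
next
  fix f g :: "('a, 'b) mfps" assume "f \<noteq> g"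
  then obtain m where m: "mcoeff f m \<noteq> mcoeff g m" using mfps_eqI by blast
  let ?U = "\<lambda>f. {h. mcoeff h m = mcoeff (f :: ('a, 'b) mfps) m}"
  have "open (?U f)" for f
    unfolding open_mfps_def by (auto intro!: exI[of _ "{m}"])
  then show "\<exists>U V. open U \<and> open V \<and> f \<in> U \<and> g \<in> V \<and> U \<inter> V = {}"
    using m by (intro exI[of _ "?U f"] exI[of _ "?U g"]) auto
qed

end

lemma tendsto_mfps_iff:
  "(f \<longlongrightarrow> l) F \<longleftrightarrow> (\<forall>m. eventually (\<lambda>x. mcoeff (f x) m = mcoeff l m) F)"
proof
  assume lim: "(f \<longlongrightarrow> l) F"
  show "\<forall>m. eventually (\<lambda>x. mcoeff (f x) m = mcoeff l m) F"
  proof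
    fix m
    have "open {h. mcoeff h m = mcoeff l m}"
      unfolding open_mfps_def by (auto intro!: exI[of _ "{m}"])
    from topological_tendstoD[OF lim this] show "eventually (\<lambda>x. mcoeff (f x) m = mcoeff l m) F"
      by simp
  qed
next
  assume ev: "\<forall>m. eventually (\<lambda>x. mcoeff (f x) m = mcoeff l m) F"
  show "(f \<longlongrightarrow> l) F"
  proof (rule topological_tendstoI)
    fix S assume "open S" "l \<in> S"
    then obtain M where M: "finite M" "\<forall>g. (\<forall>m\<in>M. mcoeff g m = mcoeff l m) \<longrightarrow> g \<in> S"
      unfolding open_mfps_def by blast
    have "eventually (\<lambda>x. \<forall>m\<in>M. mcoeff (f x) m = mcoeff l m) F"
      using M(1) ev by (simp add: eventually_ball_finite)
    then show "eventually (\<lambda>x. f x \<in> S) F"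
      by eventually_elim (use M(2) in blast)
  qed
qed

section \<open>Symmetric functions of an alphabet\<close>

text \<open>An alphabet is a family \<open>a\<close> of letters indexed by a finite or infinite set \<open>I\<close>.\<close>

definition power_sum :: "'i set \<Rightarrow> ('i \<Rightarrow> 'b::{comm_ring_1,t2_space}) \<Rightarrow> nat \<Rightarrow> 'b"
  where "power_sum I a n = (\<Sum>\<^sub>\<infinity>r\<in>I. a r ^ n)"

definition power_sum_part :: "'i set \<Rightarrow> ('i \<Rightarrow> 'b::{comm_ring_1,t2_space}) \<Rightarrow> nat list \<Rightarrow> 'b"
  where "power_sum_part I a \<mu> = prod_list (map (power_sum I a) \<mu>)"

text \<open>The expansion of \<open>1 / (1 - c u)\<close> as a power series in \<open>u\<close>.\<close>

definition fps_geom :: "'b::comm_ring_1 \<Rightarrow> 'b fps"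
  where "fps_geom c = Abs_fps (\<lambda>n. c ^ n)"

lemma fps_geom_inverse: "(1 - fps_const c * fps_X) * fps_geom c = 1"
proof (rule fps_ext)
  fix n
  show "fps_nth ((1 - fps_const c * fps_X) * fps_geom c) n = fps_nth 1 n"
    by (cases n) (simp_all add: fps_geom_def left_diff_distrib mult.assoc)
qed

text \<open>
  Letters are power series in \<open>t\<close> over \<open>'b\<close>, and generating functions are power series in \<open>s\<close>
  over those. The coefficient of \<open>s ^ n\<close> in the possibly infinite product over \<open>r \<in> I\<close> of
  \<open>G r\<close> is obtained as the limit of finite partial products. The limit is taken separately for
  each power of \<open>t\<close>, in the topology of \<open>'b\<close>: the \<open>t\<close>-adic topology carried by the type
  \<open>'b fps\<close> would be too fine, since already the degree 0 part in \<open>t\<close> of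
  \<open>\<Sum>r. x r / (1 - t * x r)\<close> is an infinite sum.
\<close>

definition prod_coeff :: "'i set \<Rightarrow> ('i \<Rightarrow> 'b::{comm_ring_1,t2_space} fps fps) \<Rightarrow> nat \<Rightarrow> 'b fps"
  where "prod_coeff I G n =
    Abs_fps (\<lambda>j. Lim (finite_subsets_at_top I) (\<lambda>F. fps_nth (fps_nth (\<Prod>r\<in>F. G r) n) j))"

definition elem_sym :: "'i set \<Rightarrow> ('i \<Rightarrow> 'b::{comm_ring_1,t2_space} fps) \<Rightarrow> nat \<Rightarrow> 'b fps"
  where "elem_sym I a n = prod_coeff I (\<lambda>r. 1 + fps_const (a r) * fps_X) n"

definition complete_sym :: "'i set \<Rightarrow> ('i \<Rightarrow> 'b::{comm_ring_1,t2_space} fps) \<Rightarrow> nat \<Rightarrow> 'b fps"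
  where "complete_sym I a n = prod_coeff I (\<lambda>r. fps_geom (a r)) n"

text \<open>The letter \<open>x / (1 - t x)\<close>, expanded in \<open>t\<close>.\<close>

definition shifted_letter :: "'b::comm_ring_1 \<Rightarrow> 'b fps"
  where "shifted_letter x = fps_const x * fps_geom x"

lemma shifted_letter_quotient: "(1 - fps_X * fps_const x) * shifted_letter x = fps_const x"
proof -
  have "(1 - fps_X * fps_const x) * shifted_letter x
      = fps_const x * ((1 - fps_const x * fps_X) * fps_geom x)"
    by (simp add: shifted_letter_def algebra_simps)
  then show ?thesis by (simp add: fps_geom_inverse)
qed

section \<open>Partitions\<close>

definition is_partition :: "nat list \<Rightarrow> bool"
  where "is_partition \<mu> \<longleftrightarrow> sorted_wrt (\<ge>) \<mu> \<and> 0 \<notin> set \<mu>"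

definition zee :: "nat list \<Rightarrow> nat"
  where "zee \<mu> = (\<Prod>i\<in>set \<mu>. i ^ count_list \<mu> i * fact (count_list \<mu> i))"

definition ferrers :: "nat list \<Rightarrow> (nat \<times> nat) set"
  where "ferrers \<mu> = {(i, j). i < length \<mu> \<and> j < \<mu> ! i}"

definition gen_binom :: "nat list \<Rightarrow> nat \<Rightarrow> nat"
  where "gen_binom \<mu> k =
    card {S. S \<subseteq> ferrers \<mu> \<and> card S = k \<and> (\<forall>i<length \<mu>. \<exists>j. (i, j) \<in> S)}"

section \<open>Convergence of the infinite sums and products\<close>

definition mideal :: "'i \<Rightarrow> ('i, 'a::comm_ring_1) mfps set"
  where "mideal i = {f. \<forall>m. i \<notin> Poly_Mapping.keys m \<longrightarrow> mcoeff f m = 0}"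

lemma mideal_0: "0 \<in> mideal i"
  by (simp add: mideal_def)

lemma mideal_mult: "f \<in> mideal i \<Longrightarrow> f * g \<in> mideal i"
  unfolding mideal_def mem_Collect_eq mcoeff_mult
proof (intro allI impI sum.neutral ballI)
  fix m p
  assume f: "\<forall>m. i \<notin> Poly_Mapping.keys m \<longrightarrow> mcoeff f m = 0" and m: "i \<notin> Poly_Mapping.keys m" and p: "p \<in> msplits m"
  have "fst p + snd p = m" using p by (simp add: msplits_def case_prod_beta)
  then have "i \<notin> Poly_Mapping.keys (fst p)" using m by (auto simp: in_keys_iff lookup_add)
  then show "(case p of (a, b) \<Rightarrow> mcoeff f a * mcoeff g b) = 0"
    using f by (simp add: case_prod_beta)
qed

lemma mideal_sum: "(\<And>x. x \<in> A \<Longrightarrow> f x \<in> mideal i) \<Longrightarrow> sum f A \<in> mideal i"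
  by (simp add: mideal_def)

lemma mvar_mideal: "mvar i \<in> mideal i"
  by (auto simp: mideal_def mvar_def)

lemma mvar_power_mideal: "n > 0 \<Longrightarrow> mvar i ^ n \<in> mideal i"
  by (cases n) (auto intro: mideal_mult mvar_mideal)

lemma tendsto_finite_subsets_mfps:
  fixes f :: "'i set \<Rightarrow> ('i, 'a::comm_ring_1) mfps"
  assumes step: "\<And>F r. finite F \<Longrightarrow> r \<notin> F \<Longrightarrow> f (insert r F) - f F \<in> mideal r"
  shows "(f \<longlongrightarrow> Abs_mfps (\<lambda>m. mcoeff (f (Poly_Mapping.keys m \<inter> I)) m)) (finite_subsets_at_top I)"
  unfolding tendsto_mfps_iff
proof
  fix m
  have st: "mcoeff (f (insert r F)) m = mcoeff (f F) m" if "finite F" "r \<notin> F" "r \<notin> Poly_Mapping.keys m" for F r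
  proof -
    have "mcoeff (f (insert r F)) m = mcoeff (f (insert r F) - f F + f F) m" by simp
    also have "\<dots> = mcoeff (f (insert r F) - f F) m + mcoeff (f F) m" by (rule mcoeff_add)
    finally show ?thesis using step[OF that(1,2)] that(3) by (simp add: mideal_def)
  qed
  have *: "mcoeff (f (G \<union> H)) m = mcoeff (f G) m"
    if "finite H" "finite G" "H \<inter> G = {}" "H \<inter> Poly_Mapping.keys m = {}" for G H
    using that
  proof (induction H rule: finite_induct)
    case (insert r H)
    then show ?case using st[of "G \<union> H" r] by simp
  qed simp
  have "mcoeff (f F) m = mcoeff (f (Poly_Mapping.keys m \<inter> I)) m"
    if "finite F" "Poly_Mapping.keys m \<inter> I \<subseteq> F" "F \<subseteq> I" for F
  proof -
    have "F = (Poly_Mapping.keys m \<inter> I) \<union> (F - (Poly_Mapping.keys m \<inter> I))" using that by auto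
    moreover have "mcoeff (f ((Poly_Mapping.keys m \<inter> I) \<union> (F - (Poly_Mapping.keys m \<inter> I)))) m = mcoeff (f (Poly_Mapping.keys m \<inter> I)) m"
      using that by (intro *) auto
    ultimately show ?thesis by simp
  qed
  then show "eventually (\<lambda>F. mcoeff (f F) m =
      mcoeff (Abs_mfps (\<lambda>m. mcoeff (f (Poly_Mapping.keys m \<inter> I)) m)) m) (finite_subsets_at_top I)"
    unfolding eventually_finite_subsets_at_top mcoeff_Abs
    by (intro exI[of _ "Poly_Mapping.keys m \<inter> I"] conjI allI impI) (blast intro: finite_keys)+
qed

lemma power_sum_summable:
  fixes I :: "'i set"
  assumes "n > 0"
  shows "(\<lambda>r. (mvar r :: ('i, 'a::comm_ring_1) mfps) ^ n) summable_on I"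
proof -
  have "(sum (\<lambda>r. (mvar r :: ('i, 'a) mfps) ^ n) \<longlongrightarrow>
     Abs_mfps (\<lambda>m. mcoeff (sum (\<lambda>r. mvar r ^ n) (Poly_Mapping.keys m \<inter> I)) m)) (finite_subsets_at_top I)"
    by (rule tendsto_finite_subsets_mfps) (simp add: mvar_power_mideal assms)
  then show ?thesis unfolding summable_on_def has_sum_def by blast
qed

lemma prod_coeff_tendsto:
  fixes I :: "'i set" and G :: "'i \<Rightarrow> ('i, 'a::comm_ring_1) mfps fps fps"
  assumes G: "\<And>r n j. fps_nth (fps_nth (G r - 1) n) j \<in> mideal r"
  shows "((\<lambda>F. fps_nth (fps_nth (\<Prod>r\<in>F. G r) n) j) \<longlongrightarrow> fps_nth (prod_coeff I G n) j)
    (finite_subsets_at_top I)"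
proof -
  let ?f = "\<lambda>F. fps_nth (fps_nth (\<Prod>r\<in>F. G r) n) j"
  have "\<exists>l. (?f \<longlongrightarrow> l) (finite_subsets_at_top I)"
  proof (rule exI, rule tendsto_finite_subsets_mfps)
    fix F :: "'i set" and r assume "finite F" "r \<notin> F"
    then have "?f (insert r F) - ?f F = fps_nth (fps_nth ((G r - 1) * (\<Prod>r\<in>F. G r)) n) j"
      by (simp add: left_diff_distrib)
    also have "\<dots> \<in> mideal r"
      unfolding fps_mult_nth fps_sum_nth by (intro mideal_sum mideal_mult G)
    finally show "?f (insert r F) - ?f F \<in> mideal r" .
  qed
  then obtain l where l: "(?f \<longlongrightarrow> l) (finite_subsets_at_top I)" ..
  then have "Lim (finite_subsets_at_top I) ?f = l"
    by (rule tendsto_Lim[OF finite_subsets_at_top_neq_bot])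
  with l show ?thesis by (simp add: prod_coeff_def)
qed

lemma shifted_letter_power_mideal:
  "n > 0 \<Longrightarrow> fps_nth (shifted_letter (mvar r) ^ n) j \<in> mideal r"
proof (cases n)
  case (Suc n')
  have "fps_nth (shifted_letter (mvar r)) i \<in> mideal r" for i
    by (simp add: shifted_letter_def mideal_mult mvar_mideal)
  then show ?thesis unfolding Suc power_Suc fps_mult_nth by (intro mideal_sum mideal_mult)
qed simp

lemma elem_sym_tendsto:
  fixes I :: "'i set"
  shows "((\<lambda>F. fps_nth (fps_nth
      (\<Prod>r\<in>F. 1 + fps_const (shifted_letter (mvar r :: ('i, 'a::comm_ring_1) mfps)) * fps_X) n) j)
    \<longlongrightarrow> fps_nth (elem_sym I (\<lambda>r. shifted_letter (mvar r)) n) j) (finite_subsets_at_top I)"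
  unfolding elem_sym_def
proof (rule prod_coeff_tendsto)
  fix r :: 'i and n j
  show "fps_nth (fps_nth (1 + fps_const (shifted_letter (mvar r :: ('i, 'a) mfps)) * fps_X - 1) n) j
    \<in> mideal r"
    using shifted_letter_power_mideal[of 1 r j] by (cases n) (auto simp: mideal_0 fps_X_def)
qed

lemma complete_sym_tendsto:
  fixes I :: "'i set"
  shows "((\<lambda>F. fps_nth (fps_nth
      (\<Prod>r\<in>F. fps_geom (shifted_letter (mvar r :: ('i, 'a::comm_ring_1) mfps))) n) j)
    \<longlongrightarrow> fps_nth (complete_sym I (\<lambda>r. shifted_letter (mvar r)) n) j) (finite_subsets_at_top I)"
  unfolding complete_sym_def
proof (rule prod_coeff_tendsto)
  fix r :: 'i and n j
  show "fps_nth (fps_nth (fps_geom (shifted_letter (mvar r :: ('i, 'a) mfps)) - 1) n) j \<in> mideal r"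
    using shifted_letter_power_mideal[of n r j] by (cases n) (auto simp: mideal_0 fps_geom_def)
qed

end

theory Submission
  imports Defs
begin

text \<open>
  The proof takes a logarithmic derivative. For a single letter \<open>x\<close>,
  \[ 1 - s \frac{x}{1 - tx} = \frac{1 - (t+s)x}{1 - tx}, \]
  so the generating functions of the \<open>h\<^sub>k\<close> and \<open>e\<^sub>k\<close> of the shifted alphabet are products of quotients
  of linear factors. Writing \<open>s t\<close> for \<open>s\<close> (\<open>regrade\<close>) moves the total degree into the exponent
  of \<open>t\<close>, and a letter contributes \<open>(1 - t x) / (1 - t (1 + s) x)\<close> to the complete functions and
  \<open>(1 - t (1 - s) x) / (1 - t x)\<close> to the elementary ones. Both logarithmic derivatives with respect
  to \<open>t\<close>, multiplied by \<open>t\<close>, have the form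
  \[ \varepsilon \sum_{n \ge 1} x^n ((1 + \delta s)^n - 1) t^n, \]
  with \<open>\<epsilon> = \<delta> = 1\<close> for \<open>h\<close> and \<open>\<epsilon> = \<delta> = -1\<close> for \<open>e\<close>. Adding over the letters turns \<open>x ^ n\<close> into the
  power sum \<open>p\<^sub>n\<close> (\<open>fps_geom_log_deriv\<close>, \<open>log_deriv_prod\<close>).

  A series \<open>G\<close> with constant term 1 and \<open>t G' = (\<Sum> c\<^sub>n t ^ n) G\<close> is \<open>exp (\<Sum> c\<^sub>n t ^ n / n)\<close>, whose
  coefficients are the sums of \<open>c\<^sub>\<mu> / z\<^sub>\<mu>\<close> over the partitions \<open>\<mu>\<close> of the degree. No exponential is
  formed: both sides satisfy Newton's recurrence \<open>N G\<^sub>N = \<Sum> c\<^sub>i G\<^sub>N\<^sub>-\<^sub>i\<close>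
  (\<open>cycle_index_newton\<close>, \<open>fps_nth_eq_cycle_index\<close>). Finally \<open>\<Prod> ((1 + \<delta> s) ^ \<mu>\<^sub>i - 1)\<close> enumerates
  the choices of a nonempty set of cells in every row, hence has the coefficients
  \<open>\<delta> ^ k\<close> times the generalized binomial coefficient (\<open>fps_nth_gen_binom\<close>).

  This settles finite alphabets (\<open>finite_alphabet_coefficient\<close>). For fixed powers of \<open>s\<close> and \<open>t\<close>
  only finitely many partitions are involved, so the identity passes to the limit over the
  finite subsets of \<open>I\<close>; summability in \<open>t\<close> is then a matter of degrees.
\<close>

section \<open>Regrading by total degree\<close>

text \<open>
  The substitution \<open>s \<mapsto> s t\<close> on series in \<open>s\<close> with coefficients in series in \<open>t\<close>, with the roles of
  the two variables exchanged in the result: the outer variable is now \<open>t\<close>, the inner one \<open>s\<close>.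
\<close>

definition regrade :: "'b::comm_ring_1 fps fps \<Rightarrow> 'b fps fps" where
  "regrade f = Abs_fps (\<lambda>N. Abs_fps (\<lambda>k.
     if k \<le> N then fps_nth (fps_nth f k) (N - k) else 0))"

lemma regrade_nth:
  "fps_nth (fps_nth (regrade f) N) k = (if k \<le> N then fps_nth (fps_nth f k) (N - k) else 0)"
  by (simp add: regrade_def)

text \<open>
  Total degree is additive: only splittings of the monomial \<open>s ^ k t ^ (N - k)\<close> into two monomials
  contribute to the product of the regraded series.
\<close>
lemma regrade_mult: "regrade (f * g) = regrade f * regrade g"
proof (rule fps_ext, rule fps_ext)
  fix N k
  let ?u = "\<lambda>a b. fps_nth (fps_nth f a) b"
  let ?v = "\<lambda>a b. fps_nth (fps_nth g a) b"
  let ?T = "\<lambda>a i. (if a \<le> i then ?u a (i - a) else 0)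
               * (if k - a \<le> N - i then ?v (k - a) (N - i - (k - a)) else 0)"
  have "fps_nth (fps_nth (regrade f * regrade g) N) k = (\<Sum>i=0..N. \<Sum>a=0..k. ?T a i)"
    by (simp add: fps_mult_nth fps_sum_nth regrade_nth)
  also have "\<dots> = (\<Sum>a=0..k. \<Sum>i=0..N. ?T a i)"
    by (rule sum.swap)
  also have "\<dots> = (\<Sum>a=0..k. if k \<le> N then \<Sum>b=0..N-k. ?u a b * ?v (k - a) (N - k - b) else 0)"
  proof (rule sum.cong[OF refl])
    fix a assume "a \<in> {0..k}"
    then have a: "a \<le> k" by simp
    show "(\<Sum>i=0..N. ?T a i)
        = (if k \<le> N then \<Sum>b=0..N-k. ?u a b * ?v (k - a) (N - k - b) else 0)"
    proof (cases "k \<le> N")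
      case True
      \<comment> \<open>the two conditions in \<open>?T\<close> cut the range of \<open>i\<close> down to \<open>a \<le> i \<le> N - k + a\<close>\<close>
      have "(\<Sum>i=0..N. ?T a i) = (\<Sum>i\<in>{0+a..N-k+a}. ?T a i)"
        using True a by (intro sum.mono_neutral_right) auto
      also have "\<dots> = (\<Sum>b=0..N-k. ?T a (b + a))"
        by (rule sum.shift_bounds_cl_nat_ivl)
      also have "\<dots> = (\<Sum>b=0..N-k. ?u a b * ?v (k - a) (N - k - b))"
      proof (rule sum.cong[OF refl])
        fix b assume "b \<in> {0..N-k}"
        then have "k - a \<le> N - (b + a)" "N - (b + a) - (k - a) = N - k - b"
          using True a by auto
        then show "?T a (b + a) = ?u a b * ?v (k - a) (N - k - b)" by simp
      qed
      finally show ?thesis using True by simp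
    next
      case False
      then have "?T a i = 0" if "i \<le> N" for i
        using a that by auto
      then show ?thesis using False by simp
    qed
  qed
  also have "\<dots> = fps_nth (fps_nth (regrade (f * g)) N) k"
    by (simp add: regrade_nth fps_mult_nth fps_sum_nth)
  finally show "fps_nth (fps_nth (regrade (f * g)) N) k
      = fps_nth (fps_nth (regrade f * regrade g) N) k" ..
qed

lemma regrade_1: "regrade 1 = 1"
  by (rule fps_ext, rule fps_ext) (auto simp: regrade_nth)

lemma regrade_prod: "regrade (\<Prod>r\<in>F. g r) = (\<Prod>r\<in>F. regrade (g r))"
  by (induction F rule: infinite_finite_induct) (simp_all add: regrade_1 regrade_mult)

section \<open>Letters and their logarithmic derivatives\<close>

lemma regrade_linear:
  "regrade (1 - fps_const (fps_const a * fps_X) - fps_const (fps_const b) * fps_X)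
     = 1 - fps_const (fps_const a + fps_const b * fps_X) * fps_X"
proof (rule fps_ext, rule fps_ext)
  fix N k :: nat
  have "N = 0 \<or> N = 1 \<or> N \<ge> 2" "k = 0 \<or> k = 1 \<or> k \<ge> 2" by arith+
  then show "fps_nth (fps_nth (regrade (1 - fps_const (fps_const a * fps_X)
        - fps_const (fps_const b) * fps_X)) N) k
      = fps_nth (fps_nth (1 - fps_const (fps_const a + fps_const b * fps_X) * fps_X) N) k"
    by (elim disjE) (auto simp: regrade_nth fps_X_def)
qed

text \<open>
  The effect on a quotient \<open>g\<close> of linear factors in \<open>s\<close> and \<open>t\<close>, with denominators cleared since the
  coefficients form an arbitrary commutative ring.
\<close>
lemma regrade_geometric:
  assumes "(1 - fps_const (fps_const x * fps_X) - fps_const (fps_const b) * fps_X) * g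
     = 1 - fps_const (fps_const x * fps_X) - fps_const (fps_const b') * fps_X"
  shows "(1 - fps_const (fps_const x + fps_const b * fps_X) * fps_X) * regrade g
     = 1 - fps_const (fps_const x + fps_const b' * fps_X) * fps_X"
  using arg_cong[OF assms, of regrade] by (simp add: regrade_mult regrade_linear)

text \<open>
  Clearing the denominator \<open>1 - t x\<close> of \<open>1 + \<delta> s x / (1 - t x)\<close> leaves a polynomial of total degree
  at most one, which is what makes the regraded letter a quotient of linear factors.
\<close>
lemma shifted_letter_linear:
  fixes x :: "'b::comm_ring_1"
  shows "fps_const (1 - fps_const x * fps_X) * (1 + fps_const (fps_const \<delta> * shifted_letter x) * fps_X)
    = 1 - fps_const (fps_const x * fps_X) - fps_const (fps_const (- \<delta> * x)) * fps_X"
proof -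
  have "(1 - fps_const x * fps_X) * (fps_const \<delta> * shifted_letter x) = fps_const (\<delta> * x)"
    using arg_cong[OF shifted_letter_quotient[of x], of "\<lambda>z. fps_const \<delta> * z"]
    by (simp add: mult_ac)
  then have "fps_const (1 - fps_const x * fps_X) * fps_const (fps_const \<delta> * shifted_letter x)
     = fps_const (fps_const (\<delta> * x))"
    by simp
  then show ?thesis
    by (simp add: distrib_left mult.assoc[symmetric] fps_const_sub[symmetric]
        del: fps_const_mult fps_const_sub fps_const_add)
qed

text \<open>
  For \<open>G = (1 - d X) / (1 - c X)\<close> the two factors contribute
  \<open>c X / (1 - c X) - d X / (1 - d X)\<close>; the constant terms of the geometric series cancel.
\<close>
lemma fps_geom_log_deriv:
  fixes G :: "'b::comm_ring_1 fps"
  assumes G: "(1 - fps_const c * fps_X) * G = 1 - fps_const d * fps_X"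
  shows "fps_X * fps_deriv G = (fps_geom c - fps_geom d) * G"
proof -
  define g where "g = fps_geom c"
  define h where "h = fps_geom d"
  have g: "g * (1 - fps_const c * fps_X) = 1" and h: "h * (1 - fps_const d * fps_X) = 1"
    unfolding g_def h_def using fps_geom_inverse by (simp_all add: mult.commute)
  have G': "G = g * (1 - fps_const d * fps_X)"
    using arg_cong[OF G, of "\<lambda>z. g * z"] g by (simp add: mult.assoc[symmetric])
  \<comment> \<open>the numerator of \<open>G\<close> cancels against \<open>h\<close>, leaving \<open>1 / (1 - c X)\<close>\<close>
  have hG: "h * G = g"
    using h unfolding G' by (simp add: mult.left_commute)
  have "(1 - fps_const c * fps_X) * fps_deriv G = fps_const c * G - fps_const d"
    using arg_cong[OF G, of fps_deriv] by (simp add: algebra_simps fps_const_neg[symmetric] del: fps_const_neg)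
  from arg_cong[OF this, of "\<lambda>z. g * z"] have
    D: "fps_deriv G = g * (fps_const c * G - fps_const d)"
    using g by (simp add: mult.assoc[symmetric])
  have "fps_X * fps_deriv G = g * ((fps_const c * fps_X) * G - fps_const d * fps_X)"
    unfolding D by (simp add: algebra_simps)
  also have "(fps_const c * fps_X) * G - fps_const d * fps_X = G - 1"
    using G by (simp add: algebra_simps)
  also have "g * (G - 1) = (g - h) * G"
    using hG by (simp add: algebra_simps)
  finally show ?thesis by (simp add: g_def h_def)
qed

lemma log_deriv_prod:
  fixes G :: "'i \<Rightarrow> 'b::comm_ring_1 fps"
  assumes "finite F" "\<And>r. r \<in> F \<Longrightarrow> fps_X * fps_deriv (G r) = C r * G r"
  shows "fps_X * fps_deriv (\<Prod>r\<in>F. G r) = (\<Sum>r\<in>F. C r) * (\<Prod>r\<in>F. G r)"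
  using assms
proof (induction F rule: finite_induct)
  case (insert r F)
  have "fps_X * fps_deriv (\<Prod>r\<in>insert r F. G r)
      = fps_X * fps_deriv (G r) * prod G F + G r * (fps_X * fps_deriv (prod G F))"
    using insert.hyps by (simp add: algebra_simps)
  then show ?case using insert by (simp add: algebra_simps)
qed simp

section \<open>Newton's recurrence for sums over partitions\<close>

text \<open>
  Partitions are represented as multisets here, so that a part can be added or removed
  without restoring the order.
\<close>
definition partitions :: "nat \<Rightarrow> nat multiset set" where
  "partitions N = {M. 0 \<notin># M \<and> sum_mset M = N}"

definition zee_mset :: "nat multiset \<Rightarrow> nat" where
  "zee_mset M = (\<Prod>i\<in>set_mset M. i ^ count M i * fact (count M i))"

lemma sum_mset_sum_count: "sum_mset M = (\<Sum>i\<in>set_mset M. i * count M i)" for M :: "nat multiset"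
proof -
  have "sum_mset M = (\<Sum>i\<in>A. i * count M i)" if "finite A" "set_mset M \<subseteq> A" for A
    using that(2)
  proof (induction M)
    case (add x M)
    have "(\<Sum>i\<in>A. i * count (add_mset x M) i) = (\<Sum>i\<in>A. i * count M i + (if i = x then x else 0))"
      by (rule sum.cong) auto
    then show ?case using add that by (simp add: sum.distrib)
  qed simp
  then show ?thesis by simp
qed

lemma zee_mset_superset:
  "finite A \<Longrightarrow> set_mset M \<subseteq> A \<Longrightarrow> zee_mset M = (\<Prod>i\<in>A. i ^ count M i * fact (count M i))"
  unfolding zee_mset_def by (rule prod.mono_neutral_left) (auto simp: not_in_iff)

text \<open>
  The recurrence for \<open>z\<close> behind Newton's identity: the factor \<open>i * m\<^sub>i\<close> gained with a new part is
  the total contribution of the parts \<open>i\<close> to the size of the larger partition.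
\<close>
lemma zee_mset_add: "zee_mset (add_mset i L) = i * (count L i + 1) * zee_mset L"
proof -
  let ?A = "insert i (set_mset L)"
  have "zee_mset (add_mset i L) = (\<Prod>j\<in>?A. (if j = i then i * (count L i + 1) else 1)
      * (j ^ count L j * fact (count L j)))"
    unfolding zee_mset_superset[of ?A "add_mset i L", simplified]
    by (rule prod.cong) (auto simp: algebra_simps not_in_iff)
  also have "\<dots> = i * (count L i + 1) * zee_mset L"
    by (subst zee_mset_superset[of ?A L]) (auto simp: prod.distrib)
  finally show ?thesis .
qed

lemma size_le_sum_mset: "0 \<notin># M \<Longrightarrow> size M \<le> sum_mset M" for M :: "nat multiset"
  by (induction M) auto

lemma partitions_add: "add_mset i L \<in> partitions N \<longleftrightarrow> i \<in> {1..N} \<and> L \<in> partitions (N - i)"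
  unfolding partitions_def by auto

lemma bij_betw_partition_lists:
  "bij_betw mset {\<mu>. is_partition \<mu> \<and> sum_list \<mu> = N} (partitions N)"
proof (rule bij_betwI[where g = "\<lambda>M. rev (sorted_list_of_multiset M)"])
  show "mset \<in> {\<mu>. is_partition \<mu> \<and> sum_list \<mu> = N} \<rightarrow> partitions N"
    by (auto simp: is_partition_def partitions_def sum_mset_sum_list)
  show "(\<lambda>M. rev (sorted_list_of_multiset M)) \<in> partitions N \<rightarrow> {\<mu>. is_partition \<mu> \<and> sum_list \<mu> = N}"
    by (auto simp: is_partition_def partitions_def sorted_wrt_rev simp flip: sum_mset_sum_list)
  show "rev (sorted_list_of_multiset (mset \<mu>)) = \<mu>"
    if "\<mu> \<in> {\<mu>. is_partition \<mu> \<and> sum_list \<mu> = N}" for \<mu>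
  proof -
    have "sorted (rev \<mu>)"
      using that by (simp add: is_partition_def sorted_wrt_rev)
    then have "sort \<mu> = rev \<mu>"
      by (intro properties_for_sort) auto
    then show ?thesis by simp
  qed
qed simp

lemma finite_partition_lists: "finite {\<mu>. is_partition \<mu> \<and> sum_list \<mu> = N}"
proof (rule finite_subset)
  show "finite {\<mu>. set \<mu> \<subseteq> {..N} \<and> length \<mu> \<le> N}"
    by (rule finite_lists_length_le) simp
  show "{\<mu>. is_partition \<mu> \<and> sum_list \<mu> = N} \<subseteq> {\<mu>. set \<mu> \<subseteq> {..N} \<and> length \<mu> \<le> N}"
    using size_le_sum_mset[of "mset _"]
    by (auto simp: is_partition_def sum_mset_sum_list member_le_sum_list)
qed

lemma finite_partitions: "finite (partitions N)"
  using bij_betw_finite[OF bij_betw_partition_lists] finite_partition_lists by blast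

text \<open>
  This is the cycle index of the symmetric group at \<open>c\<close>, i.e. \<open>h\<^sub>N\<close> expressed in power sums. The
  ring homomorphism \<open>\<phi>\<close> supplies the rational weights in a ring that need not be a field.
\<close>
definition cycle_index :: "('a::field_char_0 \<Rightarrow> 'b::comm_ring_1) \<Rightarrow> (nat \<Rightarrow> 'b) \<Rightarrow> nat \<Rightarrow> 'b" where
  "cycle_index \<phi> c N
    = (\<Sum>M\<in>partitions N. \<phi> (1 / of_nat (zee_mset M)) * prod_mset (image_mset c M))"

context
  fixes \<phi> :: "'a::field_char_0 \<Rightarrow> 'b::comm_ring_1" and c :: "nat \<Rightarrow> 'b"
  assumes add: "\<And>a b. \<phi> (a + b) = \<phi> a + \<phi> b"
    and mult: "\<And>a b. \<phi> (a * b) = \<phi> a * \<phi> b"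
    and one: "\<phi> 1 = 1"
begin

lemma hom_of_nat: "\<phi> (of_nat n) = of_nat n"
proof (induction n)
  case 0
  show ?case using add[of 0 0] by simp
qed (simp add: add one)

text \<open>
  Double counting of the pairs of a partition of \<open>N\<close> and a part \<open>i\<close> of it, weighted by
  \<open>i * m\<^sub>i\<close>. Summing over the parts first gives the factor \<open>N\<close>; removing the part \<open>i\<close> first
  cancels the weight against \<open>z\<close> and gives the right-hand side.
\<close>
lemma cycle_index_newton:
  "of_nat N * cycle_index \<phi> c N = (\<Sum>i=1..N. c i * cycle_index \<phi> c (N - i))"
proof -
  let ?w = "\<lambda>M. \<phi> (1 / of_nat (zee_mset M)) * prod_mset (image_mset c M)"
  have w: "of_nat (i * count (add_mset i L) i) * ?w (add_mset i L) = c i * ?w L"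
    if "i \<ge> 1" for i L
  proof -
    have "of_nat (i * count (add_mset i L) i) * \<phi> (1 / of_nat (zee_mset (add_mset i L)))
        = \<phi> (of_nat (i * (count L i + 1)) * (1 / of_nat (i * (count L i + 1) * zee_mset L)))"
      unfolding mult hom_of_nat zee_mset_add by simp
    also have "of_nat (i * (count L i + 1)) * (1 / of_nat (i * (count L i + 1) * zee_mset L))
        = (1 / of_nat (zee_mset L) :: 'a)"
    proof -
      have "of_nat (i * (count L i + 1)) \<noteq> (0::'a)"
        using that of_nat_eq_0_iff by (metis add_is_0 mult_is_0 not_one_le_zero zero_neq_one)
      then show ?thesis unfolding of_nat_mult[of "i * (count L i + 1)"] by simp
    qed
    finally show ?thesis by (simp add: mult_ac)
  qed
  have "of_nat N * cycle_index \<phi> c N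
      = (\<Sum>M\<in>partitions N. \<Sum>i\<in>set_mset M. of_nat (i * count M i) * ?w M)"
    unfolding cycle_index_def sum_distrib_left
    by (rule sum.cong)
      (auto simp: partitions_def sum_mset_sum_count sum_distrib_right simp del: of_nat_mult)
  also have "\<dots> = (\<Sum>(M, i)\<in>Sigma (partitions N) set_mset. of_nat (i * count M i) * ?w M)"
    by (rule sum.Sigma) (auto simp: finite_partitions)
  also have "\<dots> = (\<Sum>(i, L)\<in>Sigma {1..N} (\<lambda>i. partitions (N - i)). c i * ?w L)"
  proof (rule sum.reindex_bij_witness
      [where i = "\<lambda>(i, L). (add_mset i L, i)" and j = "\<lambda>(M, i). (i, M - {#i#})"], goal_cases)
    case (2 a)
    then obtain M i where a: "a = (M, i)" "M \<in> partitions N" "i \<in># M" by auto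
    then show ?case using partitions_add[of i "M - {#i#}" N] by simp
  next
    case (4 a)
    then show ?case using partitions_add by auto
  next
    case (5 a)
    then obtain M i where a: "a = (M, i)" "M \<in> partitions N" "i \<in># M" by auto
    then have M: "M = add_mset i (M - {#i#})" and "i \<ge> 1"
      by (auto simp: partitions_def intro!: Suc_leI Nat.gr0I)
    from w[OF this(2), of "M - {#i#}", folded M] show ?case using a by simp
  qed auto
  also have "\<dots> = (\<Sum>i=1..N. c i * cycle_index \<phi> c (N - i))"
    unfolding cycle_index_def sum_distrib_left
    by (rule sum.Sigma[symmetric]) (auto simp: finite_partitions)
  finally show ?thesis .
qed

text \<open>
  The recurrence determines the coefficients because every positive integer is invertible
  in the image of \<open>\<phi>\<close>.
\<close>
lemma fps_nth_eq_cycle_index: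
  assumes G0: "fps_nth G 0 = 1" and C0: "fps_nth C 0 = 0"
    and C: "\<And>i. i \<ge> 1 \<Longrightarrow> fps_nth C i = c i"
    and deriv: "fps_X * fps_deriv G = C * G"
  shows "fps_nth G N = cycle_index \<phi> c N"
proof (induction N rule: less_induct)
  case (less N)
  show ?case
  proof (cases "N = 0")
    case True
    have "M = {#}" if "M \<in> partitions 0" for M
      using that size_le_sum_mset[of M] unfolding partitions_def mem_Collect_eq
      by (metis le_zero_eq size_eq_0_iff_empty)
    then have "partitions 0 = {{#}}"
      by (auto simp: partitions_def)
    then show ?thesis using True G0 by (simp add: cycle_index_def zee_mset_def one)
  next
    case False
    have "of_nat N * fps_nth G N = fps_nth (fps_X * fps_deriv G) N"
      using False by (cases N) (auto simp del: of_nat_Suc)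
    also have "\<dots> = (\<Sum>i=0..N. fps_nth C i * fps_nth G (N - i))"
      by (simp add: deriv fps_mult_nth)
    also have "\<dots> = (\<Sum>i=1..N. c i * cycle_index \<phi> c (N - i))"
      by (simp add: sum.atLeast_Suc_atMost C0 C less.IH)
    finally have *: "of_nat N * fps_nth G N = of_nat N * cycle_index \<phi> c N"
      by (simp add: cycle_index_newton)
    have inv: "\<phi> (1 / of_nat N) * of_nat N = 1"
      using False by (simp add: hom_of_nat[symmetric] mult[symmetric] one)
    show ?thesis
      using arg_cong[OF *, of "\<lambda>z. \<phi> (1 / of_nat N) * z"] inv
      by (simp add: mult.assoc[symmetric])
  qed
qed

end

section \<open>Generalized binomial coefficients\<close>

lemma sum_nonempty_subsets:
  fixes y :: "'b::comm_ring_1"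
  assumes "finite A"
  shows "(\<Sum>T\<in>Pow A - {{}}. y ^ card T) = (1 + y) ^ card A - 1"
proof -
  have "(1 + y) ^ card A = (\<Sum>T\<in>Pow A. y ^ card T)"
    using prod_add[OF assms, of "\<lambda>_. y" "\<lambda>_. 1"] by (simp add: add.commute)
  also have "\<dots> = 1 + (\<Sum>T\<in>Pow A - {{}}. y ^ card T)"
    using assms by (subst sum.remove[of _ "{}"]) auto
  finally show ?thesis by simp
qed

text \<open>
  The factor of a row of length \<open>n\<close> enumerates its nonempty subsets by cardinality, and a set of
  cells meeting every row is a family of such subsets.
\<close>
lemma gen_binom_generating:
  fixes y :: "'b::comm_ring_1"
  shows "prod_list (map (\<lambda>n. (1 + y) ^ n - 1) \<mu>)
    = (\<Sum>S | S \<subseteq> ferrers \<mu> \<and> (\<forall>i<length \<mu>. \<exists>j. (i, j) \<in> S). y ^ card S)"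
proof -
  let ?l = "length \<mu>"
  let ?B = "\<lambda>i. Pow {..<\<mu> ! i} - {{}}"
  let ?row = "\<lambda>S. restrict (\<lambda>i. {j. (i, j) \<in> S}) {..<?l}"
  have "prod_list (map (\<lambda>n. (1 + y) ^ n - 1) \<mu>) = (\<Prod>i<?l. \<Sum>T\<in>?B i. y ^ card T)"
    by (simp add: prod.list_conv_set_nth sum_nonempty_subsets atLeast0LessThan)
  also have "\<dots> = (\<Sum>T\<in>PiE {..<?l} ?B. \<Prod>i<?l. y ^ card (T i))"
    by (rule prod_sum_PiE) auto
  also have "\<dots> = (\<Sum>S | S \<subseteq> ferrers \<mu> \<and> (\<forall>i<?l. \<exists>j. (i, j) \<in> S). y ^ card S)"
  proof (rule sym, rule sum.reindex_bij_witness[where i = "Sigma {..<?l}" and j = ?row], goal_cases)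
      case (1 S)
    then show ?case by (auto simp: ferrers_def)
  next
    case (2 S)
    show ?case
    proof (rule PiE_I)
      fix i assume "i \<in> {..<?l}"
      then show "?row S i \<in> ?B i"
        using 2 by (auto simp: ferrers_def)
    qed simp
  next
    case (3 T)
    show ?case
    proof
      fix i
      show "?row (Sigma {..<?l} T) i = T i"
        using PiE_arb[OF 3, of i] by (cases "i < ?l") simp_all
    qed
  next
    case (4 T)
    have "\<exists>j. (i, j) \<in> Sigma {..<?l} T" if "i < ?l" for i
      using PiE_mem[OF 4, of i] that by auto
    moreover have "Sigma {..<?l} T \<subseteq> ferrers \<mu>"
      using PiE_mem[OF 4] by (fastforce simp: ferrers_def)
    ultimately show ?case by blast
  next
    case (5 S)
    define T where "T = ?row S"
    have "finite (T i)" if "i < ?l" for i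
      using 5 that by (auto simp: T_def ferrers_def intro: finite_subset[of _ "{..<\<mu> ! i}"])
    moreover have S: "S = Sigma {..<?l} T"
      using 5 by (auto simp: T_def ferrers_def)
    ultimately have "card S = (\<Sum>i<?l. card (T i))"
      unfolding S by (intro card_SigmaI) auto
    then show ?case unfolding T_def by (simp add: power_sum)
  qed
  finally show ?thesis .
qed

lemma finite_ferrers: "finite (ferrers \<mu>)"
proof -
  have "ferrers \<mu> = (SIGMA i:{..<length \<mu>}. {..<\<mu> ! i})"
    by (auto simp: ferrers_def)
  then show ?thesis by simp
qed

lemma fps_nth_gen_binom:
  fixes \<delta> :: "'b::comm_ring_1"
  shows "fps_nth (prod_list (map (\<lambda>n. (1 + fps_const \<delta> * fps_X) ^ n - 1) \<mu>)) k
    = \<delta> ^ k * of_nat (gen_binom \<mu> k)"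
proof -
  let ?A = "{S. S \<subseteq> ferrers \<mu> \<and> (\<forall>i<length \<mu>. \<exists>j. (i, j) \<in> S)}"
  have fin: "finite ?A"
    by (rule finite_subset[of _ "Pow (ferrers \<mu>)"]) (auto simp: finite_ferrers)
  have "fps_nth (prod_list (map (\<lambda>n. (1 + fps_const \<delta> * fps_X) ^ n - 1) \<mu>)) k
      = (\<Sum>S\<in>?A. if card S = k then \<delta> ^ k else 0)"
    by (auto simp: gen_binom_generating fps_sum_nth power_mult_distrib fps_const_power
        fps_X_power_nth intro!: sum.cong)
  also have "\<dots> = \<delta> ^ k * of_nat (card {S\<in>?A. card S = k})"
    using fin by (simp add: sum.If_cases Int_def mult.commute)
  also have "{S\<in>?A. card S = k}
      = {S. S \<subseteq> ferrers \<mu> \<and> card S = k \<and> (\<forall>i<length \<mu>. \<exists>j. (i, j) \<in> S)}"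
    by auto
  finally show ?thesis by (simp add: gen_binom_def)
qed

section \<open>Limits over finite alphabets\<close>

lemma tendsto_mfps_mult:
  assumes "(f \<longlongrightarrow> a) A" "(g \<longlongrightarrow> b) A"
  shows "((\<lambda>x. f x * g x) \<longlongrightarrow> a * (b :: ('i, 'a::comm_ring_1) mfps)) A"
  unfolding tendsto_mfps_iff
proof
  fix m
  have "eventually (\<lambda>x. \<forall>p\<in>msplits m. mcoeff (f x) (fst p) = mcoeff a (fst p)
      \<and> mcoeff (g x) (snd p) = mcoeff b (snd p)) A"
    using assms by (simp add: eventually_ball_finite tendsto_mfps_iff eventually_conj_iff)
  then show "eventually (\<lambda>x. mcoeff (f x * g x) m = mcoeff (a * b) m) A"
    by eventually_elim (auto simp: mcoeff_mult case_prod_beta intro!: sum.cong)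
qed

lemma tendsto_mfps_sum:
  assumes "finite S" "\<And>s. s \<in> S \<Longrightarrow> (f s \<longlongrightarrow> a s) A"
  shows "((\<lambda>x. \<Sum>s\<in>S. f s x) \<longlongrightarrow> (\<Sum>s\<in>S. a s :: ('i, 'a::comm_ring_1) mfps)) A"
  unfolding tendsto_mfps_iff
proof
  fix m
  have "eventually (\<lambda>x. \<forall>s\<in>S. mcoeff (f s x) m = mcoeff (a s) m) A"
    using assms by (simp add: eventually_ball_finite tendsto_mfps_iff)
  then show "eventually (\<lambda>x. mcoeff (\<Sum>s\<in>S. f s x) m = mcoeff (\<Sum>s\<in>S. a s) m) A"
    by eventually_elim simp
qed

lemma power_sum_part_tendsto:
  assumes "0 \<notin> set \<mu>"
  shows "((\<lambda>F. prod_list (map (\<lambda>n. \<Sum>r\<in>F. (mvar r :: ('i, 'a::comm_ring_1) mfps) ^ n) \<mu>))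
    \<longlongrightarrow> power_sum_part I mvar \<mu>) (finite_subsets_at_top I)"
  using assms
proof (induction \<mu>)
  case (Cons n \<mu>)
  then have "((\<lambda>F. \<Sum>r\<in>F. (mvar r :: ('i, 'a) mfps) ^ n) \<longlongrightarrow> power_sum I mvar n)
      (finite_subsets_at_top I)"
    using has_sum_infsum[OF power_sum_summable[of n I]]
    by (simp add: has_sum_def power_sum_def)
  with Cons show ?case by (simp add: power_sum_part_def tendsto_mfps_mult)
qed (simp add: power_sum_part_def)

text \<open>
  Each power of \<open>t\<close> receives contributions from the partitions of a single size only, of which
  there are finitely many, so the sum converges \<open>t\<close>-adically.
\<close>
lemma has_sum_graded_partitions:
  fixes a :: "nat list \<Rightarrow> 'b::comm_ring_1"
  assumes g: "\<And>j. fps_nth g j = (\<Sum>\<mu> | is_partition \<mu> \<and> sum_list \<mu> = k + j. a \<mu>)"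
  shows "((\<lambda>\<mu>. fps_X ^ (sum_list \<mu> - k) * fps_const (a \<mu>)) has_sum g)
    {\<mu>. is_partition \<mu> \<and> sum_list \<mu> \<ge> k}" (is "(?f has_sum g) ?A")
  unfolding has_sum_def tendsto_fps_iff
proof
  fix n
  let ?P = "{\<mu>. is_partition \<mu> \<and> sum_list \<mu> = k + n}"
  have "fps_nth (sum ?f F) n = fps_nth g n" if F: "finite F" "?P \<subseteq> F" "F \<subseteq> ?A" for F
  proof -
    have "fps_nth (sum ?f F) n = (\<Sum>\<mu>\<in>F. if sum_list \<mu> - k = n then a \<mu> else 0)"
      by (auto simp: fps_sum_nth fps_X_power_mult_nth intro!: sum.cong)
    also have "\<dots> = (\<Sum>\<mu>\<in>?P. a \<mu>)"
      using F by (intro sum.mono_neutral_cong_right) auto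
    finally show ?thesis by (simp add: g)
  qed
  then show "eventually (\<lambda>F. fps_nth (sum ?f F) n = fps_nth g n) (finite_subsets_at_top ?A)"
    unfolding eventually_finite_subsets_at_top
    by (intro exI[of _ ?P]) (auto simp: finite_partition_lists)
qed

lemma mconst_add: "mconst (a + b) = mconst a + mconst b"
  by (rule mfps_eqI) (simp add: mconst_def)

lemma mconst_0: "mconst 0 = 0"
  by (rule mfps_eqI) (simp add: mconst_def)

lemma mconst_1: "mconst 1 = 1"
  by (rule mfps_eqI) (simp add: mconst_def mcoeff_1)

lemma mconst_mult: "mconst (a * b) = mconst a * mconst b"
proof (rule mfps_eqI)
  fix m
  have "mcoeff (mconst a * mconst b) m
      = (\<Sum>p\<in>msplits m. if p = (0, 0) then a * b else 0)"
    unfolding mcoeff_mult by (rule sum.cong) (auto simp: mconst_def split: if_splits)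
  also have "\<dots> = mcoeff (mconst (a * b)) m"
    by (auto simp: mconst_def msplits_def sum.delta' finite_msplits[unfolded msplits_def])
  finally show "mcoeff (mconst (a * b)) m = mcoeff (mconst a * mconst b) m" ..
qed

section \<open>The expansion in power sums\<close>

lemma cycle_index_partition_lists:
  fixes \<phi> :: "'a::field_char_0 \<Rightarrow> 'b::comm_ring_1"
  shows "cycle_index \<phi> c N
    = (\<Sum>\<mu> | is_partition \<mu> \<and> sum_list \<mu> = N. \<phi> (1 / of_nat (zee \<mu>)) * prod_list (map c \<mu>))"
proof -
  have "zee_mset (mset \<mu>) = zee \<mu>" for \<mu>
    by (simp add: zee_mset_def zee_def count_mset count_list_eq_length_filter)
  moreover have "cycle_index \<phi> c N = (\<Sum>\<mu> | is_partition \<mu> \<and> sum_list \<mu> = N.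
      \<phi> (1 / of_nat (zee_mset (mset \<mu>))) * prod_mset (image_mset c (mset \<mu>)))"
    unfolding cycle_index_def
    by (rule sum.reindex_bij_betw[OF bij_betw_partition_lists, symmetric])
  ultimately show ?thesis
    by (simp add: prod_mset_prod_list flip: mset_map)
qed

text \<open>
  The complete and the elementary case at once: \<open>\<epsilon>\<close> is the exponent with which the letter
  \<open>(1 - t x) / (1 - t (1 + \<delta> s) x)\<close> occurs, and \<open>\<delta>\<close> is the sign of \<open>s\<close>. Hence \<open>\<epsilon>\<close> is counted once
  for every part and \<open>\<delta>\<close> once for every chosen cell.
\<close>
lemma finite_alphabet_coefficient:
  fixes \<phi> :: "'a::field_char_0 \<Rightarrow> 'b::comm_ring_1" and x :: "'i \<Rightarrow> 'b" and \<delta> \<epsilon> :: 'a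
  assumes add: "\<And>a b. \<phi> (a + b) = \<phi> a + \<phi> b"
    and mult: "\<And>a b. \<phi> (a * b) = \<phi> a * \<phi> b"
    and one: "\<phi> 1 = 1"
    and F: "finite F"
    and init: "\<And>r. fps_nth (regrade (g r)) 0 = 1"
    and deriv: "\<And>r. fps_X * fps_deriv (regrade (g r))
      = fps_const (fps_const (\<phi> \<epsilon>))
        * (fps_geom (fps_const (x r) * (1 + fps_const (\<phi> \<delta>) * fps_X)) - fps_geom (fps_const (x r)))
        * regrade (g r)"
  shows "fps_nth (fps_nth (\<Prod>r\<in>F. g r) k) j
    = (\<Sum>\<mu> | is_partition \<mu> \<and> sum_list \<mu> = k + j.
        \<phi> (\<epsilon> ^ length \<mu> * \<delta> ^ k * (of_nat (gen_binom \<mu> k) / of_nat (zee \<mu>)))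
          * prod_list (map (\<lambda>n. \<Sum>r\<in>F. x r ^ n) \<mu>))"
proof -
  let ?p = "\<lambda>n. \<Sum>r\<in>F. x r ^ n"
  let ?q = "1 + fps_const (\<phi> \<delta>) * fps_X"
  let ?G = "\<Prod>r\<in>F. regrade (g r)"
  let ?C = "\<Sum>r\<in>F. fps_const (fps_const (\<phi> \<epsilon>))
      * (fps_geom (fps_const (x r) * ?q) - fps_geom (fps_const (x r)))"
  have pow: "\<phi> (a ^ n) = \<phi> a ^ n" for a n
    by (induction n) (simp_all add: one mult)
  have nat: "\<phi> (of_nat n) = of_nat n" for n
    by (rule hom_of_nat) (rule add mult one)+
  have "fps_nth ?G 0 = 1"
    using F by (induction F rule: finite_induct) (simp_all add: init)
  moreover have "fps_X * fps_deriv ?G = ?C * ?G"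
    by (rule log_deriv_prod[OF F]) (rule deriv)
  moreover have C: "fps_nth ?C n = fps_const (\<phi> \<epsilon> * ?p n) * (?q ^ n - 1)" for n
  proof -
    have "fps_nth ?C n
        = (\<Sum>r\<in>F. fps_const (\<phi> \<epsilon>) * (fps_const (x r ^ n) * (?q ^ n - 1)))"
      by (simp add: fps_sum_nth fps_geom_def power_mult_distrib fps_const_power right_diff_distrib)
    also have "\<dots> = (\<Sum>r\<in>F. fps_const (\<phi> \<epsilon> * x r ^ n)) * (?q ^ n - 1)"
      by (simp add: sum_distrib_right mult.assoc flip: fps_const_mult)
    also have "(\<Sum>r\<in>F. fps_const (\<phi> \<epsilon> * x r ^ n)) = fps_const (\<phi> \<epsilon> * ?p n)"
      by (rule fps_ext) (simp add: fps_sum_nth sum_distrib_left)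
    finally show ?thesis .
  qed
  moreover have "fps_nth ?C 0 = 0"
    by (subst C) simp
  ultimately have "fps_nth ?G (k + j)
      = cycle_index (\<lambda>a. fps_const (\<phi> a)) (\<lambda>n. fps_const (\<phi> \<epsilon> * ?p n) * (?q ^ n - 1)) (k + j)"
    by (intro fps_nth_eq_cycle_index[where C = ?C]) (simp_all only: add mult one fps_const_add fps_const_mult fps_const_1_eq_1)
  also have "\<dots> = (\<Sum>\<mu> | is_partition \<mu> \<and> sum_list \<mu> = k + j.
      fps_const (\<phi> (\<epsilon> ^ length \<mu> / of_nat (zee \<mu>)) * prod_list (map ?p \<mu>))
        * prod_list (map (\<lambda>n. ?q ^ n - 1) \<mu>))"
    unfolding cycle_index_partition_lists
  proof (rule sum.cong[OF refl])
    fix \<mu>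
    have "prod_list (map (\<lambda>n. fps_const (\<phi> \<epsilon> * ?p n) * (?q ^ n - 1)) \<mu>)
        = fps_const (\<phi> (\<epsilon> ^ length \<mu>) * prod_list (map ?p \<mu>)) * prod_list (map (\<lambda>n. ?q ^ n - 1) \<mu>)"
      unfolding pow by (induction \<mu>) (simp_all add: mult_ac flip: fps_const_mult)
    moreover have "\<phi> (\<epsilon> ^ length \<mu> / of_nat (zee \<mu>)) = \<phi> (1 / of_nat (zee \<mu>)) * \<phi> (\<epsilon> ^ length \<mu>)"
      by (simp flip: mult)
    ultimately show "fps_const (\<phi> (1 / of_nat (zee \<mu>)))
          * prod_list (map (\<lambda>n. fps_const (\<phi> \<epsilon> * ?p n) * (?q ^ n - 1)) \<mu>)
        = fps_const (\<phi> (\<epsilon> ^ length \<mu> / of_nat (zee \<mu>)) * prod_list (map ?p \<mu>))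
          * prod_list (map (\<lambda>n. ?q ^ n - 1) \<mu>)"
      by (simp add: mult.assoc flip: fps_const_mult)
  qed
  finally have "fps_nth (fps_nth ?G (k + j)) k
      = (\<Sum>\<mu> | is_partition \<mu> \<and> sum_list \<mu> = k + j.
          \<phi> (\<epsilon> ^ length \<mu> / of_nat (zee \<mu>)) * prod_list (map ?p \<mu>)
            * (\<phi> \<delta> ^ k * of_nat (gen_binom \<mu> k)))"
    by (simp add: fps_sum_nth fps_nth_gen_binom)
  also have "\<dots> = (\<Sum>\<mu> | is_partition \<mu> \<and> sum_list \<mu> = k + j.
        \<phi> (\<epsilon> ^ length \<mu> * \<delta> ^ k * (of_nat (gen_binom \<mu> k) / of_nat (zee \<mu>)))
          * prod_list (map ?p \<mu>))"
  proof (rule sum.cong[OF refl])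
    fix \<mu>
    have "\<phi> (\<epsilon> ^ length \<mu> * \<delta> ^ k * (of_nat (gen_binom \<mu> k) / of_nat (zee \<mu>)))
        = \<phi> (\<epsilon> ^ length \<mu> / of_nat (zee \<mu>) * (\<delta> ^ k * of_nat (gen_binom \<mu> k)))"
      by (simp add: mult_ac)
    also have "\<dots> = \<phi> (\<epsilon> ^ length \<mu> / of_nat (zee \<mu>)) * (\<phi> \<delta> ^ k * of_nat (gen_binom \<mu> k))"
      unfolding mult pow nat ..
    finally show "\<phi> (\<epsilon> ^ length \<mu> / of_nat (zee \<mu>)) * prod_list (map ?p \<mu>)
          * (\<phi> \<delta> ^ k * of_nat (gen_binom \<mu> k))
        = \<phi> (\<epsilon> ^ length \<mu> * \<delta> ^ k * (of_nat (gen_binom \<mu> k) / of_nat (zee \<mu>)))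
          * prod_list (map ?p \<mu>)"
      by (simp add: mult_ac)
  qed
  finally show ?thesis
    by (simp add: regrade_nth flip: regrade_prod)
qed

text \<open>
  Passage to an arbitrary alphabet: \<open>L\<close> is the coefficientwise limit of the finite products, and
  the finite identity is transported to it by uniqueness of limits.
\<close>
lemma has_sum_power_sum_expansion:
  fixes I :: "'i set" and g :: "'i \<Rightarrow> ('i, 'a::field_char_0) mfps fps fps" and \<delta> \<epsilon> :: 'a
  assumes lim: "\<And>j. ((\<lambda>F. fps_nth (fps_nth (\<Prod>r\<in>F. g r) k) j) \<longlongrightarrow> fps_nth L j)
      (finite_subsets_at_top I)"
    and init: "\<And>r. fps_nth (regrade (g r)) 0 = 1"
    and deriv: "\<And>r. fps_X * fps_deriv (regrade (g r))
      = fps_const (fps_const (mconst \<epsilon>))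
        * (fps_geom (fps_const (mvar r) * (1 + fps_const (mconst \<delta>) * fps_X))
           - fps_geom (fps_const (mvar r))) * regrade (g r)"
  shows "((\<lambda>\<mu>. fps_X ^ (sum_list \<mu> - k)
      * fps_const (mconst (\<epsilon> ^ length \<mu> * \<delta> ^ k * (of_nat (gen_binom \<mu> k) / of_nat (zee \<mu>)))
          * power_sum_part I mvar \<mu>)) has_sum L)
    {\<mu>. is_partition \<mu> \<and> sum_list \<mu> \<ge> k}"
proof (rule has_sum_graded_partitions)
  fix j
  let ?P = "{\<mu>. is_partition \<mu> \<and> sum_list \<mu> = k + j}"
  let ?w = "\<lambda>\<mu>. mconst (\<epsilon> ^ length \<mu> * \<delta> ^ k * (of_nat (gen_binom \<mu> k) / of_nat (zee \<mu>)))"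
  have "((\<lambda>F. \<Sum>\<mu>\<in>?P. ?w \<mu> * prod_list (map (\<lambda>n. \<Sum>r\<in>F. mvar r ^ n) \<mu>))
      \<longlongrightarrow> (\<Sum>\<mu>\<in>?P. ?w \<mu> * power_sum_part I mvar \<mu>)) (finite_subsets_at_top I)"
    by (intro tendsto_mfps_sum tendsto_mfps_mult tendsto_const power_sum_part_tendsto
        finite_partition_lists) (simp add: is_partition_def)
  moreover have "eventually (\<lambda>F. (\<Sum>\<mu>\<in>?P. ?w \<mu> * prod_list (map (\<lambda>n. \<Sum>r\<in>F. mvar r ^ n) \<mu>))
      = fps_nth (fps_nth (\<Prod>r\<in>F. g r) k) j) (finite_subsets_at_top I)"
    by (rule eventually_finite_subsets_at_top_weakI)
      (rule finite_alphabet_coefficient[where \<phi> = mconst, symmetric];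
        simp add: mconst_add mconst_mult mconst_1 init deriv)
  ultimately have "((\<lambda>F. fps_nth (fps_nth (\<Prod>r\<in>F. g r) k) j)
      \<longlongrightarrow> (\<Sum>\<mu>\<in>?P. ?w \<mu> * power_sum_part I mvar \<mu>)) (finite_subsets_at_top I)"
    by (rule Lim_transform_eventually)
  with lim[of j] show "fps_nth L j = (\<Sum>\<mu>\<in>?P. ?w \<mu> * power_sum_part I mvar \<mu>)"
    by (rule tendsto_unique[OF finite_subsets_at_top_neq_bot])
qed

lemma regrade_complete_letter:
  fixes x :: "'b::comm_ring_1"
  shows "(1 - fps_const (fps_const x * (1 + fps_X)) * fps_X) * regrade (fps_geom (shifted_letter x))
    = 1 - fps_const (fps_const x) * fps_X"
proof -
  let ?y = "shifted_letter x"
  have "1 + fps_const (fps_const (- 1) * ?y) * fps_X = 1 - fps_const ?y * fps_X"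
    by (simp flip: fps_const_neg)
  with shifted_letter_linear[of x "- 1"]
  have linear: "fps_const (1 - fps_const x * fps_X) * (1 - fps_const ?y * fps_X)
      = 1 - fps_const (fps_const x * fps_X) - fps_const (fps_const x) * fps_X"
    by simp
  have "(1 - fps_const (fps_const x * fps_X) - fps_const (fps_const x) * fps_X) * fps_geom ?y
      = fps_const (1 - fps_const x * fps_X) * ((1 - fps_const ?y * fps_X) * fps_geom ?y)"
    by (simp only: linear mult.assoc[symmetric])
  also have "\<dots> = 1 - fps_const (fps_const x * fps_X) - fps_const (fps_const 0) * fps_X"
    by (simp add: fps_geom_inverse flip: fps_const_sub)
  finally show ?thesis
    using regrade_geometric by (fastforce simp: distrib_left)
qed

lemma regrade_elementary_letter:
  fixes x :: "'b::comm_ring_1"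
  shows "(1 - fps_const (fps_const x) * fps_X)
      * regrade (1 + fps_const (shifted_letter x) * fps_X)
    = 1 - fps_const (fps_const x * (1 - fps_X)) * fps_X"
proof -
  have "(1 - fps_const (fps_const x * fps_X) - fps_const (fps_const 0) * fps_X)
      * (1 + fps_const (shifted_letter x) * fps_X)
      = 1 - fps_const (fps_const x * fps_X) - fps_const (fps_const (- x)) * fps_X"
    using shifted_letter_linear[of x 1] by (simp flip: fps_const_sub)
  from regrade_geometric[OF this] show ?thesis
    by (simp add: right_diff_distrib flip: fps_const_neg)
qed

lemma fps_nth_0_linear:
  assumes "(1 - fps_const c * fps_X) * G = 1 - fps_const d * fps_X"
  shows "fps_nth G 0 = (1 :: 'b::comm_ring_1)"
  using arg_cong[OF assms, of "\<lambda>f. fps_nth f 0"] by simp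

theorem mainTheorem2:
  fixes I :: "'i set" and k :: nat
  assumes "k \<ge> 1"
  shows "((\<lambda>\<mu>. fps_X ^ (sum_list \<mu> - k)
            * fps_const (mconst (of_nat (gen_binom \<mu> k) / of_nat (zee \<mu>))
                * power_sum_part I (mvar :: 'i \<Rightarrow> ('i, 'a::field_char_0) mfps) \<mu>))
          has_sum complete_sym I (\<lambda>r. shifted_letter (mvar r)) k)
         {\<mu>. is_partition \<mu> \<and> sum_list \<mu> \<ge> k}
    \<and> ((\<lambda>\<mu>. fps_X ^ (sum_list \<mu> - k)
            * fps_const (mconst ((- 1) powi (int k - int (length \<mu>))
                * (of_nat (gen_binom \<mu> k) / of_nat (zee \<mu>)))
                * power_sum_part I (mvar :: 'i \<Rightarrow> ('i, 'a) mfps) \<mu>))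
          has_sum elem_sym I (\<lambda>r. shifted_letter (mvar r)) k)
         {\<mu>. is_partition \<mu> \<and> sum_list \<mu> \<ge> k}"
proof (rule conjI, goal_cases)
  case 1
  note factor = regrade_complete_letter[of "mvar _ :: ('i, 'a) mfps"]
  \<comment> \<open>\<open>\<epsilon> = \<delta> = 1\<close>\<close>
  have "((\<lambda>\<mu>. fps_X ^ (sum_list \<mu> - k)
      * fps_const (mconst (1 ^ length \<mu> * 1 ^ k * (of_nat (gen_binom \<mu> k) / of_nat (zee \<mu>)))
          * power_sum_part I (mvar :: 'i \<Rightarrow> ('i, 'a) mfps) \<mu>))
      has_sum complete_sym I (\<lambda>r. shifted_letter (mvar r)) k)
    {\<mu>. is_partition \<mu> \<and> sum_list \<mu> \<ge> k}"
    by (rule has_sum_power_sum_expansion[OF complete_sym_tendsto fps_nth_0_linear[OF factor]])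
      (simp add: fps_geom_log_deriv[OF factor] mconst_1)
  then show ?case by simp
next
  case 2
  note factor = regrade_elementary_letter[of "mvar _ :: ('i, 'a) mfps"]
  have neg: "mconst (- 1 :: 'a) = (- 1 :: ('i, 'a) mfps)"
  proof -
    have "mconst (- 1) + mconst 1 = (mconst 0 :: ('i, 'a) mfps)"
      by (simp flip: mconst_add)
    then show ?thesis by (simp add: mconst_1 mconst_0 eq_neg_iff_add_eq_0)
  qed
  have sign: "(- 1) powi (int k - int n) = ((- 1) ^ n * (- 1) ^ k :: 'a)" for n
    by (simp add: power_int_diff minus_one_power_iff)
  \<comment> \<open>\<open>\<epsilon> = \<delta> = - 1\<close>, because the letter is the inverse of the complete one with \<open>s\<close> negated\<close>
  have "((\<lambda>\<mu>. fps_X ^ (sum_list \<mu> - k)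
      * fps_const (mconst ((- 1) ^ length \<mu> * (- 1) ^ k * (of_nat (gen_binom \<mu> k) / of_nat (zee \<mu>)))
          * power_sum_part I (mvar :: 'i \<Rightarrow> ('i, 'a) mfps) \<mu>))
      has_sum elem_sym I (\<lambda>r. shifted_letter (mvar r)) k)
    {\<mu>. is_partition \<mu> \<and> sum_list \<mu> \<ge> k}"
    by (rule has_sum_power_sum_expansion[OF elem_sym_tendsto fps_nth_0_linear[OF factor]])
      (simp add: fps_geom_log_deriv[OF factor] neg flip: fps_const_neg)
  then show ?case by (simp add: sign)
qed

end
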